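(* In a super-agreeable society with a circular political spectrum, there is an option that is approved by a strict majority of the voters. That is: let $C$ be a circle, let $n\ge 1$, and for each voter $i\in\{1,\dots,n\}$ let $A_i\subseteq C$ be a closed set (the approval set of voter $i$) and $p_i\in A_i$ a point (the position of voter $i$), such that for each pair of voters $i,j$ at least one of the paths in $C$ between $p_i$ and $p_j$ is contained in $A_i\cup A_j$. Then there is a point $x\in C$ such that $|\{i : x\in A_i\}|>n/2$.
   Context: A political spectrum is the set of all options available to voters; here it is (topologically) a circle $C$. The approval set of a voter is the set of options that voter approves; approval sets are closed subsets of the spectrum. A society is the set of all voters together with their approval sets. A society with circular political spectrum is super-agreeable if for each pair of voters $i,j$, one of the paths between $i$ and $j$ is covered by their approval sets, where each voter $i$ is identified with a position $p_i$ on the circle belonging to her approval set. Between two distinct points of the circle there are exactly two paths (the two closed arcs joining them); if $p_i=p_j$ the trivial path $\{p_i\}$ counts as a path between them. *)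

theory Defs
  imports "HOL-Analysis.Analysis"
begin

definition circle :: "'a::topological_space set \<Rightarrow> bool"
  where "circle C \<longleftrightarrow> C homeomorphic sphere (0::complex) 1"

(* Paths are treated as point sets.  For p = q no arc exists (arcs are injective), and
   only the trivial path remains; for p \<noteq> q on a circle C these are precisely the
   two closed arcs of C joining p and q. *)
definition paths_between :: "'a::topological_space set \<Rightarrow> 'a \<Rightarrow> 'a \<Rightarrow> 'a set set"
  where "paths_between C p q =
    (if p = q then {{p}}
     else {path_image g |g. arc g \<and> path_image g \<subseteq> C \<and> pathstart g = p \<and> pathfinish g = q})"

(* V is the set of voters, A i the approval set and p i the position of voter i. *)
definition super_agreeable ::
    "'a::topological_space set \<Rightarrow> 'v set \<Rightarrow> ('v \<Rightarrow> 'a set) \<Rightarrow> ('v \<Rightarrow> 'a) \<Rightarrow> bool"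
  where "super_agreeable C V A p \<longleftrightarrow>
    (\<forall>i\<in>V. p i \<in> A i) \<and>
    (\<forall>i\<in>V. \<forall>j\<in>V. \<exists>P\<in>paths_between C (p i) (p j). P \<subseteq> A i \<union> A j)"

end

theory Submission
  imports Defs
begin

text \<open>
  Why a strict majority exists.  Fix an option \<open>x\<close> and let \<open>N\<close> be the set of the voters who reject
  it.  For two voters in \<open>N\<close> the path covered by their approval sets cannot pass through \<open>x\<close>, so it
  lies in the circle punctured at \<open>x\<close>, which is a line.  On a line, a society in which every pair of
  voters covers the segment between their positions has an option approved by everybody
  (\<open>linear_society_common_option\<close>).  Hence some option \<open>y\<close> is approved by all of \<open>N\<close>
  (\<open>super_agreeable_option_for_rejecters\<close>).

  Now suppose that no option has a strict majority.  Then \<open>x\<close> is rejected by at least half of the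
  voters, and \<open>y\<close> is approved by all of these but by at most half of the voters; so exactly half of
  the voters approve \<open>x\<close>.  As \<open>x\<close> was arbitrary, the approval sets cover every point of the circle
  equally often.  They are closed and the circle is connected, which forces each of them to be empty
  or the whole circle (\<open>connected_constant_multiplicity\<close>).  They contain the positions, so they are
  all equal to the circle, and every option is approved unanimously: a contradiction.
\<close>

text \<open>
  If there were no common point, every real \<open>x\<close> would be missed by some \<open>A i\<close>.  All the \<open>A i\<close> that
  miss \<open>x\<close> have their \<open>p i\<close> on the same side of \<open>x\<close>, for otherwise \<open>x\<close> would be in a covered
  segment.  The points with the missing voters on their left form an open set, as the \<open>A i\<close> are
  closed, and so do those with the missing voters on their right.  The rightmost position is of the
  first kind and the leftmost of the second, so the two sets disconnect the line.
\<close>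

lemma linear_society_common_option:
  fixes A :: "'v \<Rightarrow> real set" and p :: "'v \<Rightarrow> real"
  assumes fin: "finite S"
    and clo: "\<And>i. i \<in> S \<Longrightarrow> closed (A i)"
    and seg: "\<And>i j. i \<in> S \<Longrightarrow> j \<in> S \<Longrightarrow> closed_segment (p i) (p j) \<subseteq> A i \<union> A j"
  shows "\<exists>x. \<forall>i\<in>S. x \<in> A i"
proof (rule ccontr)
  assume none: "\<not> (\<exists>x. \<forall>i\<in>S. x \<in> A i)"
  define U where "U = (\<Union>i\<in>S. {p i<..} - A i)"
  define W where "W = (\<Union>i\<in>S. {..<p i} - A i)"
  have pin: "p i \<in> A i" if "i \<in> S" for i
    using seg[OF that that] by simp
  have cover: "x \<in> U \<union> W" for x
  proof -
    obtain i where i: "i \<in> S" "x \<notin> A i"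
      using none by blast
    then have "p i < x \<or> x < p i"
      using pin by (metis linorder_less_linear)
    then show ?thesis
      using i by (auto simp: U_def W_def)
  qed
  have disj: "U \<inter> W = {}"
  proof -
    have False if "i \<in> S" "j \<in> S" "p i < x" "x < p j" "x \<notin> A i" "x \<notin> A j" for i j x
    proof -
      have "x \<in> closed_segment (p i) (p j)"
        using that by (simp add: closed_segment_eq_real_ivl)
      then show False
        using seg[OF that(1,2)] that(5,6) by blast
    qed
    then show ?thesis
      by (auto simp: U_def W_def)
  qed
  have "open U" "open W"
    unfolding U_def W_def using clo by (auto intro!: open_UN open_Diff)
  moreover have "Max (p ` S) \<in> U"
  proof -
    have "Max (p ` S) \<notin> W"
      using fin by (auto simp: W_def not_less)
    then show ?thesis
      using cover by blast
  qed
  moreover have "Min (p ` S) \<in> W"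
  proof -
    have "Min (p ` S) \<notin> U"
      using fin by (auto simp: U_def not_less)
    then show ?thesis
      using cover by blast
  qed
  moreover have "connected (UNIV :: real set)"
    by (rule connected_UNIV)
  ultimately show False
    using cover disj unfolding connected_def by blast
qed

text \<open>
  The complement of a member \<open>A i\<close> is again closed: \<open>x\<close> lies outside \<open>A i\<close> precisely when it lies in
  some \<open>k\<close> of the other sets, so the complement is a finite union of finite intersections of the
  \<open>A j\<close>.
\<close>

lemma connected_constant_multiplicity:
  assumes conn: "connected X" and fin: "finite V"
    and clo: "\<And>i. i \<in> V \<Longrightarrow> closedin (top_of_set X) (A i)"
    and mult: "\<And>x. x \<in> X \<Longrightarrow> card {i \<in> V. x \<in> A i} = k"
    and i: "i \<in> V"
  shows "A i = {} \<or> A i = X"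
proof -
  define F where "F = {T. T \<subseteq> V - {i} \<and> card T = k}"
  have compl: "X - A i = (\<Union>T\<in>F. {x \<in> X. \<forall>j\<in>T. x \<in> A j})" (is "_ = ?R")
  proof (intro equalityI subsetI)
    fix x assume x: "x \<in> X - A i"
    then have "{j \<in> V. x \<in> A j} \<in> F"
      using mult by (auto simp: F_def)
    then show "x \<in> ?R"
      using x by blast
  next
    fix x assume "x \<in> ?R"
    then obtain T where T: "T \<subseteq> V - {i}" "card T = k" and x: "x \<in> X" "\<forall>j\<in>T. x \<in> A j"
      by (auto simp: F_def)
    have "T = {j \<in> V. x \<in> A j}"
      using T x mult[OF x(1)] fin by (intro card_subset_eq) auto
    then show "x \<in> X - A i"
      using T x i by blast
  qed
  have "closedin (top_of_set X) (\<Union>T\<in>F. {x \<in> X. \<forall>j\<in>T. x \<in> A j})"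
  proof (rule closedin_Union, safe)
    show "finite ((\<lambda>T. {x \<in> X. \<forall>j\<in>T. x \<in> A j}) ` F)"
      using fin by (auto simp: F_def)
  next
    fix T assume "T \<in> F"
    then have T: "\<And>j. j \<in> T \<Longrightarrow> closedin (top_of_set X) (A j)"
      using clo by (auto simp: F_def)
    have "{x \<in> X. \<forall>j\<in>T. x \<in> A j} = \<Inter> (insert X (A ` T))"
      by auto
    moreover have "closedin (top_of_set X) (\<Inter> (insert X (A ` T)))"
      using T by (intro closedin_Inter) auto
    ultimately show "closedin (top_of_set X) {x \<in> X. \<forall>j\<in>T. x \<in> A j}"
      by simp
  qed
  then have "openin (top_of_set X) (A i)"
    using closedin_subset[OF clo[OF i]] by (simp add: compl [symmetric] openin_closedin_eq)
  then show ?thesis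
    using conn clo[OF i] by (auto simp: connected_clopen)
qed

lemma connected_circle:
  assumes "circle C"
  shows "connected C"
proof -
  have "connected (sphere (0::complex) 1)"
    by (rule connected_sphere) simp
  then show ?thesis
    using assms homeomorphic_connectedness unfolding circle_def by blast
qed

lemma punctured_circle_homeomorphic_line:
  assumes "circle C" and x: "x \<in> C"
  shows "(C - {x}) homeomorphic (UNIV :: real set)"
proof -
  obtain f g where fg: "homeomorphism C (sphere (0::complex) 1) f g"
    using assms(1) unfolding circle_def homeomorphic_def by blast
  have img: "f ` C = sphere 0 1" and inj: "inj_on f C"
    using fg by (auto simp only: homeomorphism_def intro: inj_on_inverseI)
  have "f ` (C - {x}) = sphere 0 1 - {f x}"
    using inj_on_image_set_diff[OF inj, of C "{x}"] img x by simp
  then have "homeomorphism (C - {x}) (sphere 0 1 - {f x}) f g"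
    by (intro homeomorphism_of_subsets[OF fg]) auto
  then have "(C - {x}) homeomorphic (sphere 0 1 - {f x})"
    unfolding homeomorphic_def by blast
  moreover have "f x \<in> sphere 0 1"
    using img x by blast
  then have "(sphere 0 1 - {f x}) homeomorphic (UNIV :: real set)"
    by (intro homeomorphic_punctured_sphere_affine) (auto simp: aff_dim_UNIV)
  ultimately show ?thesis
    by (rule homeomorphic_trans)
qed

lemma paths_between_connected:
  assumes "P \<in> paths_between C p q"
  shows "connected P" "p \<in> P" "q \<in> P"
  using assms
  by (auto simp: paths_between_def connected_path_image arc_imp_path split: if_splits)

text \<open>
  In the punctured circle the rejecters of \<open>x\<close> form a linear society.  A covered path is
  connected, so its image in the line contains the whole segment between the two positions.
\<close>

lemma super_agreeable_option_for_rejecters: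
  fixes C :: "'a::topological_space set" and A :: "'v \<Rightarrow> 'a set"
  assumes C: "circle C" and fin: "finite V"
    and clo: "\<And>i. i \<in> V \<Longrightarrow> closedin (top_of_set C) (A i)"
    and agree: "super_agreeable C V A p"
    and x: "x \<in> C"
  shows "\<exists>y\<in>C. \<forall>i\<in>V. x \<notin> A i \<longrightarrow> y \<in> A i"
proof -
  define N where "N = {i \<in> V. x \<notin> A i}"
  obtain h g where hg: "homeomorphism (C - {x}) (UNIV :: real set) h g"
    using punctured_circle_homeomorphic_line[OF C x] unfolding homeomorphic_def by blast
  have sub: "A i \<subseteq> C - {x}" if "i \<in> N" for i
    using clo closedin_imp_subset that by (fastforce simp: N_def)
  have "\<exists>t. \<forall>i\<in>N. t \<in> h ` A i"
  proof (rule linear_society_common_option)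
    show "finite N"
      using fin by (auto simp: N_def)
  next
    fix i assume i: "i \<in> N"
    have "closedin (top_of_set (C - {x})) (A i)"
      using clo sub[OF i] i by (auto simp: N_def intro: closedin_subset_trans)
    then show "closed (h ` A i)"
      using homeomorphism_imp_closed_map[OF hg] by fastforce
  next
    fix i j assume i: "i \<in> N" and j: "j \<in> N"
    obtain P where P: "P \<in> paths_between C (p i) (p j)" "P \<subseteq> A i \<union> A j"
      using agree i j unfolding super_agreeable_def N_def by blast
    note P' = paths_between_connected[OF P(1)]
    have "P \<subseteq> C - {x}"
      using P(2) sub[OF i] sub[OF j] by blast
    then have "connected (h ` P)"
      using P'(1) hg by (meson connected_continuous_image continuous_on_subset homeomorphism_def)
    then have "closed_segment (h (p i)) (h (p j)) \<subseteq> h ` P"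
      using P'(2,3)
      by (intro closed_segment_subset) (auto simp: is_interval_connected_1 [symmetric] is_interval_convex_1 [symmetric])
    then show "closed_segment (h (p i)) (h (p j)) \<subseteq> h ` A i \<union> h ` A j"
      using P(2) by blast
  qed
  then obtain t where t: "\<And>i. i \<in> N \<Longrightarrow> t \<in> h ` A i"
    by blast
  have "g t \<in> A i" if i: "i \<in> N" for i
  proof -
    obtain a where "a \<in> A i" "t = h a"
      using t[OF i] by blast
    moreover have "g (h a) = a"
      using homeomorphism_apply1[OF hg, of a] sub[OF i] \<open>a \<in> A i\<close> by blast
    ultimately show ?thesis
      by simp
  qed
  moreover have "g t \<in> C"
    using hg by (auto simp: homeomorphism_def)
  ultimately show ?thesis
    by (auto simp: N_def)
qed

theorem theorem15:
  fixes C :: "'a::topological_space set"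
    and n :: nat
    and A :: "nat \<Rightarrow> 'a set"
    and p :: "nat \<Rightarrow> 'a"
  assumes "circle C"
    and "n \<ge> 1"
    and "\<And>i. i \<in> {1..n} \<Longrightarrow> closedin (top_of_set C) (A i)"
    and "super_agreeable C {1..n} A p"
  shows "\<exists>x\<in>C. real (card {i \<in> {1..n}. x \<in> A i}) > real n / 2"
proof (rule ccontr)
  define app where "app x = {i \<in> {1..n}. x \<in> A i}" for x
  assume "\<not> ?thesis"
  then have le: "2 * card (app x) \<le> n" if "x \<in> C" for x
    using that by (force simp: app_def not_less)
  have half: "card (app x) = n div 2" if x: "x \<in> C" for x
  proof -
    obtain y where y: "y \<in> C" "\<forall>i\<in>{1..n}. x \<notin> A i \<longrightarrow> y \<in> A i"
      using super_agreeable_option_for_rejecters[OF assms(1) _ assms(3,4) x] by auto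
    have "n = card (app x) + card ({1..n} - app x)"
    proof -
      have "{1..n} \<inter> app x = app x"
        by (auto simp: app_def)
      then show ?thesis
        using card_Int_Diff[of "{1..n}" "app x"] by simp
    qed
    also have "card ({1..n} - app x) \<le> card (app y)"
      using y(2) by (intro card_mono) (auto simp: app_def)
    finally show ?thesis
      using le[OF x] le[OF y(1)] by linarith
  qed
  have pin: "p i \<in> A i" if "i \<in> {1..n}" for i
    using assms(4) that by (auto simp: super_agreeable_def)
  have all: "A i = C" if i: "i \<in> {1..n}" for i
    using connected_constant_multiplicity[OF connected_circle[OF assms(1)] _ assms(3)
        half[unfolded app_def] i] pin[OF i]
    by auto
  have "p 1 \<in> C"
    using pin[of 1] all[of 1] assms(2) by auto
  moreover from this have "app (p 1) = {1..n}"
    using all by (auto simp: app_def)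
  ultimately show False
    using le[of "p 1"] assms(2) by simp
qed

end
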